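(* For all integers $n\geq 0$ and $k\geq 1$, \begin{align*} \overline{R_{3k}^\ast}(3n+1)&\equiv 0 \pmod{2},\\ \overline{R_{3k}^\ast}(3n+2)&\equiv 0 \pmod{4}. \end{align*}
   Context: An overpartition of $n$ is a partition of $n$ in which the first occurrence of each part size may optionally be overlined. For a positive integer $\ell$, $\overline{R_\ell^\ast}(n)$ denotes the number of overpartitions of $n$ in which no non-overlined part is divisible by $\ell$. Equivalently, with $f_k:=\prod_{i\geq 1}(1-q^{ki})$, one has $\sum_{n\geq 0}\overline{R_\ell^\ast}(n)q^n = \frac{f_2 f_\ell}{f_1^2}$. *)

theory Defs
  imports Main "HOL-Library.Multiset" "HOL-Number_Theory.Cong"
begin

text \<open>
  A partition of \<open>n\<close> is a finite multiset of positive integers with sum \<open>n\<close>.  As only the first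
  occurrence of each part size may be overlined, an overpartition is determined by the underlying
  partition \<open>M\<close> (all parts, overlined or not) together with the set \<open>S\<close> of those part sizes whose
  first occurrence is overlined.
\<close>

definition overpartitions :: "nat \<Rightarrow> (nat multiset \<times> nat set) set" where
  "overpartitions n = {(M, S). 0 \<notin># M \<and> sum_mset M = n \<and> S \<subseteq> set_mset M}"

text \<open>Overlining removes exactly one copy of each size in \<open>S\<close> from the non-overlined parts.\<close>

definition nonoverlined_parts :: "nat multiset \<times> nat set \<Rightarrow> nat multiset" where
  "nonoverlined_parts = (\<lambda>(M, S). M - mset_set S)"

definition R_star_bar :: "nat \<Rightarrow> nat \<Rightarrow> nat" where
  "R_star_bar l n =
     card {p \<in> overpartitions n. \<forall>x \<in># nonoverlined_parts p. \<not> l dvd x}"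

text \<open>The cardinality above is that of a finite set.\<close>

lemma finite_overpartitions: "finite (overpartitions n)"
proof -
  have size_le: "size M \<le> sum_mset M" if "0 \<notin># M" for M :: "nat multiset"
    using that by (induction M) auto
  have elem_le: "x \<le> sum_mset M" if "x \<in># M" for x and M :: "nat multiset"
    using that by (metis le_add1 multi_member_split sum_mset.add_mset)
  have "finite {xs. set xs \<subseteq> {..n} \<and> length xs \<le> n}"
    by (rule finite_lists_length_le) simp
  then have "finite (mset ` {xs. set xs \<subseteq> {..n} \<and> length xs \<le> n} \<times> Pow {..n})"
    by simp
  moreover have "overpartitions n \<subseteq> mset ` {xs. set xs \<subseteq> {..n} \<and> length xs \<le> n} \<times> Pow {..n}"
  proof
    fix p assume "p \<in> overpartitions n"
    then obtain M S where p: "p = (M, S)" "0 \<notin># M" "sum_mset M = n" "S \<subseteq> set_mset M"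
      by (auto simp: overpartitions_def)
    obtain xs where xs: "mset xs = M" using ex_mset by blast
    have "set_mset M \<subseteq> {..n}" "size M \<le> n" using size_le[of M] elem_le[of _ M] p by auto
    then have "set xs \<subseteq> {..n}" "length xs \<le> n" using xs by auto
    then show "p \<in> mset ` {xs. set xs \<subseteq> {..n} \<and> length xs \<le> n} \<times> Pow {..n}"
      using p xs \<open>set_mset M \<subseteq> {..n}\<close> by auto
  qed
  ultimately show ?thesis by (rule finite_subset[rotated])
qed

end

theory Submission
  imports Defs
begin

text \<open>
  In an admissible overpartition a size divisible by \<open>l\<close> occurs once and is overlined, while the
  first occurrence of any other size is overlined or not at will.  Hence the count is the sum of
  \<open>2 ^ c(M)\<close> over the underlying partitions \<open>M\<close>, where \<open>c(M)\<close> is the number of distinct sizes not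
  divisible by \<open>l\<close>.  If \<open>3\<close> divides \<open>l\<close> but not \<open>n\<close>, then \<open>c(M) > 0\<close>.  Modulo \<open>4\<close> only those \<open>M\<close>
  with \<open>c(M) = 1\<close> matter; they consist of \<open>a\<close> copies of some \<open>i\<close> and of multiples of \<open>l\<close>.  For
  \<open>n \<equiv> 2\<close> modulo \<open>3\<close> we have \<open>a * i \<equiv> 2\<close>, so exchanging \<open>a\<close> and \<open>i\<close> is an involution, and it has no
  fixed point because \<open>2\<close> is not a square modulo \<open>3\<close>.
\<close>

text \<open>These are exactly the partitions that admit at least one admissible overlining.\<close>

definition star_partitions :: "nat \<Rightarrow> nat \<Rightarrow> nat multiset set" where
  "star_partitions l n =
     {M. 0 \<notin># M \<and> sum_mset M = n \<and> (\<forall>x\<in>#M. l dvd x \<longrightarrow> count M x = 1)}"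

definition free_sizes :: "nat \<Rightarrow> nat multiset \<Rightarrow> nat set" where
  "free_sizes l M = {x \<in> set_mset M. \<not> l dvd x}"

lemma finite_star_partitions: "finite (star_partitions l n)"
proof (rule finite_subset)
  show "star_partitions l n \<subseteq> fst ` overpartitions n"
    by (force simp: star_partitions_def overpartitions_def image_iff)
qed (simp add: finite_overpartitions)

lemma finite_free_sizes: "finite (free_sizes l M)"
  by (simp add: free_sizes_def)

text \<open>Deleting one copy of each size in \<open>S\<close> makes a size of \<open>M\<close>
  disappear exactly when it occurs once and lies in \<open>S\<close>.\<close>

lemma nonoverlined_parts_not_dvd_iff:
  assumes "S \<subseteq> set_mset M"
  shows "(\<forall>x\<in>#nonoverlined_parts (M, S). \<not> l dvd x) \<longleftrightarrow>
         (\<forall>x\<in>#M. l dvd x \<longrightarrow> count M x = 1 \<and> x \<in> S)"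
proof -
  have "finite S"
    using assms finite_subset by blast
  then have count: "count (nonoverlined_parts (M, S)) x = count M x - (if x \<in> S then 1 else 0)" for x
    by (simp add: nonoverlined_parts_def)
  have "x \<in># nonoverlined_parts (M, S) \<longleftrightarrow> x \<in># M \<and> \<not> (count M x = 1 \<and> x \<in> S)" for x
    unfolding count_greater_zero_iff[symmetric] count using assms by (auto intro!: Suc_lessI)
  then show ?thesis
    by blast
qed

lemma R_star_bar_eq_sum: "R_star_bar l n = (\<Sum>M\<in>star_partitions l n. 2 ^ card (free_sizes l M))"
proof -
  \<comment> \<open>For \<open>M\<close> in \<open>star_partitions l n\<close> this is the fibre of
    admissible overlinings over \<open>M\<close>.\<close>
  define F where "F M = {S. S \<subseteq> set_mset M \<and> set_mset M - free_sizes l M \<subseteq> S}" for M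
  have eq: "{p \<in> overpartitions n. \<forall>x\<in>#nonoverlined_parts p. \<not> l dvd x}
            = Sigma (star_partitions l n) F" (is "?L = ?R")
  proof -
    have "(M, S) \<in> ?L \<longleftrightarrow> (M, S) \<in> ?R" for M S
    proof (cases "S \<subseteq> set_mset M")
      case True
      then show ?thesis
        unfolding mem_Collect_eq nonoverlined_parts_not_dvd_iff[OF True]
        by (auto simp: overpartitions_def star_partitions_def F_def free_sizes_def)
    qed (simp add: overpartitions_def F_def)
    then show ?thesis
      unfolding set_eq_iff split_paired_All by blast
  qed
  have "card (F M) = 2 ^ card (free_sizes l M)" for M
  proof -
    \<comment> \<open>The sizes divisible by \<open>l\<close> are forced into \<open>S\<close>, so
      \<open>S\<close> is determined by its trace on the free sizes, which is arbitrary.\<close>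
    have "bij_betw (\<lambda>S. S \<union> (set_mset M - free_sizes l M)) (Pow (free_sizes l M)) (F M)"
      by (rule bij_betw_byWitness[where f' = "\<lambda>S. S \<inter> free_sizes l M"])
        (auto simp: F_def free_sizes_def)
    then show ?thesis
      by (metis bij_betw_same_card card_Pow finite_free_sizes)
  qed
  moreover have "finite (F M)" for M
    by (rule finite_subset[of _ "Pow (set_mset M)"]) (auto simp: F_def)
  ultimately show ?thesis
    unfolding R_star_bar_def eq by (simp add: card_SigmaI finite_star_partitions)
qed

lemma card_free_sizes_pos:
  assumes "M \<in> star_partitions l n" "\<not> l dvd n"
  shows "card (free_sizes l M) > 0"
proof -
  have "free_sizes l M \<noteq> {}"
  proof
    assume "free_sizes l M = {}"
    then have "\<forall>x\<in>#M. l dvd x"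
      by (auto simp: free_sizes_def)
    then have "l dvd sum_mset M"
      by (induction M) auto
    with assms show False
      by (simp add: star_partitions_def)
  qed
  then show ?thesis
    by (simp add: card_gt_0_iff finite_free_sizes)
qed

text \<open>Swapping the last two components exchanges the triples with \<open>a < b\<close> and
  those with \<open>b < a\<close>, and no others exist. The first component is only carried along.
  An infinite \<open>T\<close> has cardinality 0.\<close>

lemma even_card_swap:
  assumes sym: "\<And>x a b. (x, a, b) \<in> T \<Longrightarrow> (x, b, a) \<in> T"
    and irrefl: "\<And>x a. (x, a, a) \<notin> T"
  shows "even (card (T :: ('a \<times> 'b::linorder \<times> 'b) set))"
proof (cases "finite T")
  case True
  let ?L = "{(x, a, b) \<in> T. a < b}" and ?G = "{(x, a, b) \<in> T. b < a}"
  have "a < b \<or> b < a" if "(x, a, b) \<in> T" for x a b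
    using irrefl that by (metis neq_iff)
  then have "T = ?L \<union> ?G"
    by auto
  then have "card T = card (?L \<union> ?G)"
    by (rule arg_cong)
  also have "\<dots> = card ?L + card ?G"
    by (rule card_Un_disjoint) (auto intro: finite_subset[OF _ True])
  finally have "card T = card ?L + card ?G" .
  moreover have "bij_betw (\<lambda>(x, a, b). (x, b, a)) ?L ?G"
    by (rule bij_betw_byWitness[where f' = "\<lambda>(x, a, b). (x, b, a)"]) (auto dest: sym)
  then have "card ?L = card ?G"
    by (rule bij_betw_same_card)
  ultimately show ?thesis
    by simp
qed simp

lemma even_card_single_free_size:
  assumes "3 dvd l" "n mod 3 = 2"
  shows "even (card {M \<in> star_partitions l n. card (free_sizes l M) = 1})"
proof -
  \<comment> \<open>A triple encodes a partition with one free size: \<open>D\<close> collects the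
    multiples of \<open>l\<close>, and \<open>i\<close> is the free size with multiplicity
    \<open>a\<close>.\<close>
  define T where "T = {(D :: nat multiset, a, i).
    0 \<notin># D \<and> (\<forall>x\<in>#D. l dvd x \<and> count D x = 1) \<and> 0 < a \<and> \<not> l dvd i \<and> sum_mset D + a * i = n}"
  define glue :: "nat multiset \<times> nat \<times> nat \<Rightarrow> nat multiset"
    where "glue = (\<lambda>(D, a, i). D + replicate_mset a i)"
  define cut where "cut M =
    (let i = the_elem (free_sizes l M) in (filter_mset ((dvd) l) M, count M i, i))" for M
  let ?B = "{M \<in> star_partitions l n. card (free_sizes l M) = 1}"
  have prod_mod: "(a * i) mod 3 = 2" if "(D, a, i) \<in> T" for D a i
  proof -
    have "\<forall>x\<in>#D. 3 dvd x"
      using that assms(1) dvd_trans by (auto simp: T_def)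
    then have "3 dvd sum_mset D"
      by (induction D) auto
    moreover have "sum_mset D + a * i = n"
      using that by (simp add: T_def)
    ultimately show ?thesis
      using assms(2) by presburger
  qed
  have "even (card T)"
  proof (rule even_card_swap)
    fix D a i assume T: "(D, a, i) \<in> T"
    \<comment> \<open>After the swap \<open>a\<close> is the free size and \<open>i\<close> the
      multiplicity, so \<open>a\<close> must not be divisible by \<open>l\<close> and
      \<open>i\<close> must be positive.\<close>
    have "\<not> 3 dvd a * i"
      using prod_mod[OF T] by (simp add: dvd_eq_mod_eq_0)
    then have "\<not> 3 dvd a" "0 < i"
      by (auto intro!: Nat.gr0I)
    moreover from this have "\<not> l dvd a"
      using assms(1) dvd_trans by blast
    ultimately show "(D, i, a) \<in> T"
      using T by (auto simp: T_def mult.commute)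
  next
    fix D :: "nat multiset" and a :: nat
    \<comment> \<open>The squares modulo 3 are 0 and 1, whereas a fixed point would need
      \<open>a * a\<close> to be 2.\<close>
    have "a mod 3 = 0 \<or> a mod 3 = 1 \<or> a mod 3 = 2"
      by presburger
    then have "(a * a) mod 3 \<noteq> 2"
      by (auto simp: mod_mult_eq[of a 3 a, symmetric])
    then show "(D, a, a) \<notin> T"
      using prod_mod by blast
  qed
  moreover have "bij_betw glue T ?B"
  proof (rule bij_betw_byWitness[where f' = cut])
    have glue: "glue (D, a, i) \<in> ?B \<and> cut (glue (D, a, i)) = (D, a, i)"
      if T: "(D, a, i) \<in> T" for D a i
    proof -
      \<comment> \<open>Positivity of \<open>i\<close> is not part of \<open>T\<close>; it follows
        because \<open>a * i\<close> is nonzero modulo 3.\<close>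
      have "i > 0"
        using prod_mod[OF T] by (auto intro!: Nat.gr0I)
      then have star: "D + replicate_mset a i \<in> star_partitions l n"
        using T by (auto simp: star_partitions_def T_def)
      have free: "free_sizes l (D + replicate_mset a i) = {i}"
        using T by (auto simp: T_def free_sizes_def)
      have "filter_mset ((dvd) l) D = D" "filter_mset ((dvd) l) (replicate_mset a i) = {#}"
        using T by (auto simp: T_def filter_mset_eq_conv)
      then have "filter_mset ((dvd) l) (D + replicate_mset a i) = D"
        by simp
      moreover have "i \<notin># D"
        using T by (auto simp: T_def)
      ultimately show ?thesis
        using star by (simp add: glue_def cut_def Let_def free not_in_iff)
    qed
    have cut: "cut M \<in> T \<and> glue (cut M) = M" if M: "M \<in> ?B" for M
    proof -
      obtain i where i: "free_sizes l M = {i}"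
        using M card_1_singletonE by blast
      then have free_iff: "x \<in># M \<and> \<not> l dvd x \<longleftrightarrow> x = i" for x
        by (auto simp: free_sizes_def)
      \<comment> \<open>Each part of \<open>M\<close> is either a multiple of \<open>l\<close> or
        equal to \<open>i\<close>, never both.\<close>
      have eq: "filter_mset ((dvd) l) M + replicate_mset (count M i) i = M"
      proof (rule multiset_eqI)
        show "count (filter_mset ((dvd) l) M + replicate_mset (count M i) i) x = count M x" for x
          using free_iff[of x] by (cases "x = i") (auto simp: not_in_iff)
      qed
      have "sum_mset (filter_mset ((dvd) l) M) + count M i * i = sum_mset M"
        \<comment> \<open>Only the \<open>M\<close> on the right-hand side is to be
          decomposed.\<close>
        by (subst (3) eq[symmetric]) (simp add: sum_mset_replicate_mset)
      then have "(filter_mset ((dvd) l) M, count M i, i) \<in> T"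
        using M free_iff[of i] by (auto simp: T_def star_partitions_def)
      then show ?thesis
        using eq by (simp add: glue_def cut_def Let_def i)
    qed
    show "\<forall>t\<in>T. cut (glue t) = t" "glue ` T \<subseteq> ?B"
      using glue by auto
    show "\<forall>M\<in>?B. glue (cut M) = M" "cut ` ?B \<subseteq> T"
      using cut by auto
  qed
  ultimately show ?thesis
    using bij_betw_same_card by fastforce
qed

lemma even_R_star_bar:
  assumes "\<not> l dvd n"
  shows "even (R_star_bar l n)"
  unfolding R_star_bar_eq_sum
  by (rule dvd_sum) (use card_free_sizes_pos[OF _ assms] in simp)

lemma four_dvd_R_star_bar:
  assumes "3 dvd l" "n mod 3 = 2"
  shows "4 dvd R_star_bar l n"
proof -
  let ?A = "star_partitions l n"
  let ?B = "{M \<in> ?A. card (free_sizes l M) = 1}"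
  have "\<not> l dvd n"
    using assms by (metis dvd_imp_mod_0 dvd_trans zero_neq_numeral)
  \<comment> \<open>Outside \<open>?B\<close> the exponent is neither 0 nor 1.\<close>
  have "4 dvd (2::nat) ^ card (free_sizes l M)" if "M \<in> ?A - ?B" for M
  proof -
    have "2 \<le> card (free_sizes l M)"
      using that card_free_sizes_pos[OF _ \<open>\<not> l dvd n\<close>, of M] by force
    then have "(2::nat) ^ 2 dvd 2 ^ card (free_sizes l M)"
      by (rule le_imp_power_dvd)
    then show ?thesis
      by simp
  qed
  then have "4 dvd (\<Sum>M\<in>?A - ?B. (2::nat) ^ card (free_sizes l M))"
    by (rule dvd_sum)
  \<comment> \<open>Each member of \<open>?B\<close> contributes 2, and the evenness of
    \<open>card ?B\<close> supplies the second factor 2.\<close>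
  moreover have "(\<Sum>M\<in>?B. (2::nat) ^ card (free_sizes l M)) = 2 * card ?B"
    by simp
  then have "4 dvd (\<Sum>M\<in>?B. (2::nat) ^ card (free_sizes l M))"
    using even_card_single_free_size[OF assms] by (auto elim!: evenE)
  moreover have "R_star_bar l n = (\<Sum>M\<in>?A - ?B. 2 ^ card (free_sizes l M)) +
      (\<Sum>M\<in>?B. 2 ^ card (free_sizes l M))"
    unfolding R_star_bar_eq_sum by (rule sum.subset_diff) (auto simp: finite_star_partitions)
  ultimately show ?thesis
    by (simp only: dvd_add)
qed

theorem theorem1p2:
  fixes n k :: nat
  assumes "k \<ge> 1"
  shows "[R_star_bar (3 * k) (3 * n + 1) = 0] (mod 2) \<and>
         [R_star_bar (3 * k) (3 * n + 2) = 0] (mod 4)"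
proof -
  have "\<not> 3 dvd 3 * n + 1"
    by presburger
  then have "\<not> 3 * k dvd 3 * n + 1"
    using dvd_mult_left by blast
  moreover have "(3 * n + 2) mod 3 = 2"
    by presburger
  ultimately show ?thesis
    by (simp add: cong_0_iff even_R_star_bar four_dvd_R_star_bar)
qed

end
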